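(* Let $\lambda^{(3)}=3.00000483430477639$. Up to transposition, a $(3,\lambda^{(3)})$-admissible word $\theta$ has the form $$\theta=\dots 2_6\,1_2\,2_8\,1_2\,2_6\,1_2\,2^*\,2_6\,1_2\,2_8\,1_2\,2_6\,1_2\,2_2\dots$$ In particular, it contains the string $\theta_3^0=2_6\,1_2\,2_8\,1_2\,2_6\,1_2\,2^*\,2_6\,1_2\,2_8\,1_2\,2_6\,1$.
   Context: All words are over the alphabet $\{1,2\}$. Subscripts indicate repetition of a character (e.g. $1_2 2_4$ is $112222$), and an asterisk marks the entry in position $0$; writing $\theta=\dots u\dots$ means that $\theta$ contains the string $u$ with its starred entry at position $0$. For $\theta=(a_n)_{n\in\mathbb{Z}}\in\{1,2\}^{\mathbb{Z}}$ put $\lambda_i(\theta)=[a_i;a_{i+1},a_{i+2},\dots]+[0;a_{i-1},a_{i-2},\dots]$ and $m(\theta)=\sup_{i\in\mathbb{Z}}\lambda_i(\theta)$. For $k\ge1$ let $\underline{\omega}_k=2_{2k}\,1_2\,2_{2k+1}\,1_2\,2_{2k+2}\,1_2$ and let $\theta(\underline{\omega}_k)$ be the bi-infinite periodic word obtained by repeating $\underline{\omega}_k$. A word $\theta\in\{1,2\}^{\mathbb{Z}}$ is $(k,\lambda)$-admissible if $m(\theta(\underline{\omega}_k))<m(\theta)=\lambda_0(\theta)<\lambda$. The transposition of $\theta=(a_n)_{n\in\mathbb{Z}}$ is $(a_{-n})_{n\in\mathbb{Z}}$; "up to transposition" means that $\theta$ or its transposition has the stated form. *)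

theory Defs
  imports "HOL-Analysis.Analysis"
begin

text \<open>Finite continued fraction \<open>[a\<^sub>0; a\<^sub>1, \<dots>, a\<^sub>n]\<close>.\<close>

primrec cf_fin :: "nat \<Rightarrow> (nat \<Rightarrow> nat) \<Rightarrow> real" where
  "cf_fin 0 a = real (a 0)"
| "cf_fin (Suc n) a = real (a 0) + 1 / cf_fin n (\<lambda>j. a (Suc j))"

text \<open>\<open>[a\<^sub>0; a\<^sub>1, a\<^sub>2, \<dots>]\<close>. The limit exists whenever the partial quotients \<open>a\<^sub>1, a\<^sub>2, \<dots>\<close>
  are positive, in particular in every use below.\<close>

definition cf :: "(nat \<Rightarrow> nat) \<Rightarrow> real" where
  "cf a = lim (\<lambda>n. cf_fin n a)"

definition biwords :: "(int \<Rightarrow> nat) set" where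
  "biwords = {\<theta>. \<forall>i. \<theta> i \<in> {1, 2}}"

definition lam :: "(int \<Rightarrow> nat) \<Rightarrow> int \<Rightarrow> real" where
  "lam \<theta> i = cf (\<lambda>n. \<theta> (i + int n)) + cf (\<lambda>n. if n = 0 then 0 else \<theta> (i - int n))"

text \<open>On \<^const>\<open>biwords\<close> the values \<open>lam \<theta> i\<close> are bounded, so the real supremum is the genuine one.\<close>

definition markov :: "(int \<Rightarrow> nat) \<Rightarrow> real" where
  "markov \<theta> = (SUP i. lam \<theta> i)"

text \<open>Run-length notation: \<open>word [(2, 6), (1, 2)]\<close> is \<open>2\<^sub>6 1\<^sub>2 = 22222211\<close>.\<close>

definition word :: "(nat \<times> nat) list \<Rightarrow> nat list" where
  "word rs = concat (map (\<lambda>(c, n). replicate n c) rs)"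

definition omega :: "nat \<Rightarrow> nat list" where
  "omega k = word [(2, 2 * k), (1, 2), (2, 2 * k + 1), (1, 2), (2, 2 * k + 2), (1, 2)]"

text \<open>One copy of \<open>w\<close> starts at position 0; the value of \<^const>\<open>markov\<close> does not depend on
  this choice.\<close>

definition periodic :: "nat list \<Rightarrow> int \<Rightarrow> nat" where
  "periodic w i = w ! nat (i mod int (length w))"

definition admissible :: "nat \<Rightarrow> real \<Rightarrow> (int \<Rightarrow> nat) \<Rightarrow> bool" where
  "admissible k \<mu> \<theta> \<longleftrightarrow> \<theta> \<in> biwords \<and>
     markov (periodic (omega k)) < markov \<theta> \<and> markov \<theta> = lam \<theta> 0 \<and> lam \<theta> 0 < \<mu>"

definition transposition :: "(int \<Rightarrow> nat) \<Rightarrow> int \<Rightarrow> nat" where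
  "transposition \<theta> i = \<theta> (- i)"

text \<open>\<open>\<theta> = \<dots> u v \<dots>\<close>, where the starred entry (position 0) is the first entry of \<open>v\<close>.\<close>

definition has_string :: "(int \<Rightarrow> nat) \<Rightarrow> nat list \<Rightarrow> nat list \<Rightarrow> bool" where
  "has_string \<theta> u v \<longleftrightarrow> map \<theta> [- int (length u)..int (length v) - 1] = u @ v"

end

theory Submission
  imports Defs
begin

text \<open>If a finite window of \<open>\<theta>\<close> is known, replacing the unknown tails of the two continued
  fractions by the extreme values 1 and 3 bounds \<open>lam \<theta> i\<close> by explicit fractions. A window around
  position 0 is impossible for an admissible word if it forces \<open>lam \<theta> 0\<close> to be at most a rational
  number just below \<open>markov (periodic (omega 3))\<close>, or forces some \<open>lam \<theta> i\<close> to be at least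
  \<open>3.00000483430477639\<close>. Starting from the empty window and prepending or appending a letter 1 or 2
  at each branching, one obtains a finite tree all of whose leaves are impossible or contain the
  asserted string or its transposition.\<close>

section \<open>Continued fractions with partial quotients 1 and 2\<close>

text \<open>The interval from 1 to 3 reproduces itself: a tail that is at least 1 has a reciprocal
  between 0 and 1, to which a letter 1 or 2 is added.\<close>

lemma cf_fin_bounds:
  assumes "\<forall>j. a j \<in> {1, 2}"
  shows "1 \<le> cf_fin n a \<and> cf_fin n a \<le> 3"
  using assms
proof (induction n arbitrary: a)
  case 0
  have "a 0 \<in> {1, 2}" using 0 by blast
  then show ?case by auto
next
  case (Suc n)
  have "1 \<le> cf_fin n (\<lambda>j. a (Suc j))"
    using Suc.IH[of "\<lambda>j. a (Suc j)"] Suc.prems by blast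
  then have "0 \<le> 1 / cf_fin n (\<lambda>j. a (Suc j))" "1 / cf_fin n (\<lambda>j. a (Suc j)) \<le> 1"
    by simp_all
  moreover have "real (a 0) \<in> {1, 2}"
    using Suc.prems by (metis insert_iff of_nat_1 of_nat_numeral singletonD)
  ultimately show ?case by auto
qed

text \<open>The difference of the reciprocals is \<open>(y - x) / (x * y)\<close>, and the product
  is at least 4/3. The asymmetry matches the use: \<open>x\<close> has positive depth, hence is at
  least 1 + 1/3, while \<open>y\<close> may be a single letter 1.\<close>

lemma inverse_contraction:
  fixes x y :: real
  assumes "4 / 3 \<le> x" "1 \<le> y"
  shows "\<bar>1 / x - 1 / y\<bar> \<le> 3 / 4 * \<bar>x - y\<bar>"
proof -
  have xy: "4 / 3 \<le> x * y"
    using mult_mono[OF assms] assms by simp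
  have "1 / x - 1 / y = (y - x) / (x * y)"
    using assms by (simp add: field_simps)
  then have "\<bar>1 / x - 1 / y\<bar> = \<bar>x - y\<bar> / (x * y)"
    using xy by (simp add: abs_divide abs_minus_commute)
  also have "\<dots> \<le> \<bar>x - y\<bar> / (4 / 3)"
    using xy by (intro divide_left_mono) auto
  finally show ?thesis by simp
qed

lemma cf_fin_diff:
  assumes "\<forall>j. a j \<in> {1, 2}"
  shows "\<bar>cf_fin (Suc n) a - cf_fin n a\<bar> \<le> (3 / 4) ^ n"
  using assms
proof (induction n arbitrary: a)
  case 0
  have "a (Suc 0) \<in> {1, 2}" using 0 by blast
  then show ?case by auto
next
  case (Suc n)
  let ?b = "\<lambda>j. a (Suc j)"
  let ?x = "cf_fin (Suc n) ?b" and ?y = "cf_fin n ?b"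
  have b: "\<forall>j. ?b j \<in> {1, 2}" using Suc.prems by blast
  have y: "1 \<le> ?y"
    using cf_fin_bounds[OF b] by blast
  have "1 \<le> cf_fin n (\<lambda>j. ?b (Suc j))" "cf_fin n (\<lambda>j. ?b (Suc j)) \<le> 3"
    using cf_fin_bounds[of "\<lambda>j. ?b (Suc j)" n] b by blast+
  then have "1 / 3 \<le> 1 / cf_fin n (\<lambda>j. ?b (Suc j))"
    by (intro divide_left_mono) auto
  moreover have "1 \<le> ?b 0" using b[rule_format, of 0] by auto
  ultimately have x: "4 / 3 \<le> ?x" by simp
  have "\<bar>cf_fin (Suc (Suc n)) a - cf_fin (Suc n) a\<bar> = \<bar>1 / ?x - 1 / ?y\<bar>"
    by (simp only: cf_fin.simps(2)[of "Suc n" a] cf_fin.simps(2)[of n a] add_diff_cancel_left)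
  also have "\<dots> \<le> 3 / 4 * \<bar>?x - ?y\<bar>"
    using x y by (rule inverse_contraction)
  also have "\<dots> \<le> 3 / 4 * (3 / 4) ^ n"
    using Suc.IH[OF b] by (intro mult_left_mono) simp_all
  finally show ?case by (simp only: power_Suc)
qed

text \<open>Consecutive approximants differ by terms of a geometric series, so the telescoping sum
  converges and the \<open>lim\<close> in \<open>cf\<close> is a genuine limit.\<close>

lemma cf_fin_LIMSEQ:
  assumes "\<forall>j. a j \<in> {1, 2}"
  shows "(\<lambda>n. cf_fin n a) \<longlonglongrightarrow> cf a"
proof -
  have "summable (\<lambda>n. cf_fin (Suc n) a - cf_fin n a)"
  proof (rule summable_comparison_test')
    show "summable (\<lambda>n. (3 / 4 :: real) ^ n)"
      by (rule summable_geometric) simp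
    show "norm (cf_fin (Suc n) a - cf_fin n a) \<le> (3 / 4) ^ n" for n
      using cf_fin_diff[OF assms] by (simp only: real_norm_def)
  qed
  then have "convergent (\<lambda>n. cf_fin n a - cf_fin 0 a)"
    unfolding summable_iff_convergent
    by (simp only: sum_lessThan_telescope[where f = "\<lambda>n. cf_fin n a"])
  then have "convergent (\<lambda>n. cf_fin n a)"
    by (simp only: convergent_diff_const_right_iff)
  then show ?thesis
    unfolding cf_def by (rule convergent_LIMSEQ_iff[THEN iffD1])
qed

lemma cf_bounds:
  assumes "\<forall>j. a j \<in> {1, 2}"
  shows "1 \<le> cf a" "cf a \<le> 3"
  using LIMSEQ_le_const[OF cf_fin_LIMSEQ[OF assms], of 1]
    LIMSEQ_le_const2[OF cf_fin_LIMSEQ[OF assms], of 3] cf_fin_bounds[OF assms]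
  by blast+

text \<open>Pass to the limit in the recursion of \<open>cf_fin\<close>; the tail has limit at least
  1, so inversion is continuous there. The first entry is left free to cover the leading 0 in
  \<open>lam\<close>.\<close>

lemma cf_unfold:
  assumes "\<forall>j. a (Suc j) \<in> {1, 2}"
  shows "cf a = real (a 0) + 1 / cf (\<lambda>j. a (Suc j))"
proof -
  have "(\<lambda>n. cf_fin (Suc n) a) \<longlonglongrightarrow> real (a 0) + 1 / cf (\<lambda>j. a (Suc j))"
    using cf_bounds(1)[OF assms] unfolding cf_fin.simps
    by (intro tendsto_intros cf_fin_LIMSEQ assms) auto
  then show ?thesis
    unfolding cf_def by (intro limI) (rule LIMSEQ_imp_Suc)
qed

lemma lam_eq:
  assumes "\<theta> \<in> biwords"
  shows "lam \<theta> i = cf (\<lambda>n. \<theta> (i + int n)) + 1 / cf (\<lambda>n. \<theta> (i - 1 - int n))"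
proof -
  have "cf (\<lambda>n. if n = 0 then 0 else \<theta> (i - int n)) = 1 / cf (\<lambda>n. \<theta> (i - 1 - int n))"
    using assms by (subst cf_unfold) (auto simp: biwords_def algebra_simps)
  then show ?thesis by (simp add: lam_def)
qed

text \<open>The supremum is over a bounded set: the forward fraction is at most 3 and the reciprocal
  of the backward one at most 1.\<close>

lemma lam_le_markov:
  assumes "\<theta> \<in> biwords"
  shows "lam \<theta> i \<le> markov \<theta>"
proof -
  have "lam \<theta> j \<le> 3 + 1" for j
    unfolding lam_eq[OF assms]
    using cf_bounds[of "\<lambda>n. \<theta> (j + int n)"] cf_bounds[of "\<lambda>n. \<theta> (j - 1 - int n)"] assms
    by (intro add_mono) (auto simp: biwords_def)
  then have "bdd_above (range (lam \<theta>))" by fast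
  then show ?thesis
    unfolding markov_def by (intro cSUP_upper) auto
qed

section \<open>Rational bounds from a finite window\<close>

text \<open>The pair \<open>(n, d)\<close> stands for the fraction \<open>n / d\<close>. Upper and lower bounds alternate because
  \<open>x \<mapsto> a + 1 / x\<close> is decreasing.\<close>

fun bound :: "bool \<Rightarrow> nat list \<Rightarrow> int \<times> int" where
  "bound upper [] = (if upper then 3 else 1, 1)"
| "bound upper (a # w) =
     (case bound (\<not> upper) w of (n, d) \<Rightarrow> ((if a = 1 then n else n + n) + d, n))"

definition prefix_of_seq :: "nat list \<Rightarrow> (nat \<Rightarrow> nat) \<Rightarrow> bool" where
  "prefix_of_seq w a \<longleftrightarrow> (\<forall>n < length w. a n = w ! n)"

lemma prefix_of_seq_Nil [simp]: "prefix_of_seq [] a"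
  by (simp add: prefix_of_seq_def)

lemma prefix_of_seq_Cons:
  "prefix_of_seq (x # w) a \<longleftrightarrow> a 0 = x \<and> prefix_of_seq w (\<lambda>n. a (Suc n))"
  by (auto simp: prefix_of_seq_def nth_Cons split: nat.splits)

lemma prefix_of_seq_snoc:
  "prefix_of_seq (w @ [x]) a \<longleftrightarrow> prefix_of_seq w a \<and> a (length w) = x"
  by (auto simp: prefix_of_seq_def nth_append less_Suc_eq)

text \<open>Positivity is part of the induction because each step inverts the fraction for the tail,
  which reverses the inequality.\<close>

lemma bound_correct:
  assumes "\<forall>j. a j \<in> {1, 2}" "prefix_of_seq w a" "bound upper w = (n, d)"
  shows "0 < n \<and> 0 < d \<and>
    (if upper then cf a \<le> of_int n / of_int d else of_int n / of_int d \<le> cf a)"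
  using assms
proof (induction upper w arbitrary: a n d rule: bound.induct)
  case (1 upper)
  then show ?case using cf_bounds[of a] by (auto split: if_splits)
next
  case (2 upper x w)
  let ?b = "\<lambda>j. a (Suc j)"
  obtain n' d' where nd: "bound (\<not> upper) w = (n', d')" by fastforce
  have b: "\<forall>j. ?b j \<in> {1, 2}" using 2 by blast
  have x: "a 0 = x" "x \<in> {1, 2}" and w: "prefix_of_seq w ?b"
    using 2 by (auto simp: prefix_of_seq_Cons)
  have IH: "0 < n'" "0 < d'"
    "if \<not> upper then cf ?b \<le> of_int n' / of_int d' else of_int n' / of_int d' \<le> cf ?b"
    using "2.IH"[OF b w nd] by auto
  have n: "n = int x * n' + d'" and d: "d = n'"
    using 2(4) nd x(2) by auto
  have "real_of_int n / of_int d = real x + 1 / (of_int n' / of_int d')"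
    using IH by (simp add: n d field_simps)
  moreover have "cf a = real x + 1 / cf ?b"
    using cf_unfold[OF b] x by simp
  moreover have "if upper then 1 / cf ?b \<le> 1 / (of_int n' / of_int d')
      else 1 / (of_int n' / of_int d') \<le> 1 / cf ?b"
    using IH cf_bounds(1)[OF b]
    by (auto simp del: divide_divide_eq_right intro!: divide_left_mono split: if_splits)
  ultimately show ?case
    using IH x by (auto simp: n d add_pos_pos split: if_splits)
qed

text \<open>\<open>window \<theta> i l r\<close> means that \<open>rev l @ r\<close> occurs in \<open>\<theta>\<close>, with \<open>r\<close> starting at position \<open>i\<close>.\<close>

definition window :: "(int \<Rightarrow> nat) \<Rightarrow> int \<Rightarrow> nat list \<Rightarrow> nat list \<Rightarrow> bool" where
  "window \<theta> i l r \<longleftrightarrow>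
     prefix_of_seq l (\<lambda>n. \<theta> (i - 1 - int n)) \<and> prefix_of_seq r (\<lambda>n. \<theta> (i + int n))"

text \<open>This is \<open>n / d + d' / n'\<close> over a common denominator. The left part enters
  \<open>lam\<close> through its reciprocal, so it is bounded in the opposite direction.\<close>

fun lam_bound :: "bool \<Rightarrow> nat list \<Rightarrow> nat list \<Rightarrow> int \<times> int" where
  "lam_bound upper l r =
     (case bound upper r of (n, d) \<Rightarrow> case bound (\<not> upper) l of (n', d') \<Rightarrow>
        (n * n' + d * d', d * n'))"

lemma lam_bound_correct:
  assumes "\<theta> \<in> biwords" "window \<theta> i l r" "lam_bound upper l r = (n, d)"
  shows "0 < d"
    "if upper then lam \<theta> i \<le> of_int n / of_int d else of_int n / of_int d \<le> lam \<theta> i"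
proof -
  let ?a = "\<lambda>n. \<theta> (i + int n)" and ?b = "\<lambda>n. \<theta> (i - 1 - int n)"
  have ab: "\<forall>j. ?a j \<in> {1, 2}" "\<forall>j. ?b j \<in> {1, 2}"
    using assms(1) by (auto simp: biwords_def)
  have w: "prefix_of_seq r ?a" "prefix_of_seq l ?b"
    using assms(2) by (auto simp: window_def)
  obtain p q p' q' where pq: "bound upper r = (p, q)" "bound (\<not> upper) l = (p', q')"
    by fastforce
  have n: "n = p * p' + q * q'" and d: "d = q * p'"
    using assms(3) pq by auto
  note A = bound_correct[OF ab(1) w(1) pq(1)] and B = bound_correct[OF ab(2) w(2) pq(2)]
  show "0 < d" using A B by (simp add: d)
  have "real_of_int n / of_int d = of_int p / of_int q + 1 / (of_int p' / of_int q')"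
    using A B by (simp add: n d field_simps)
  moreover have "if upper then 1 / cf ?b \<le> 1 / (of_int p' / of_int q')
      else 1 / (of_int p' / of_int q') \<le> 1 / cf ?b"
    using B cf_bounds(1)[OF ab(2)]
    by (auto simp del: divide_divide_eq_right intro!: divide_left_mono split: if_splits)
  ultimately show "if upper then lam \<theta> i \<le> of_int n / of_int d
      else of_int n / of_int d \<le> lam \<theta> i"
    unfolding lam_eq[OF assms(1)] using A by (auto split: if_splits)
qed

section \<open>Certified case distinctions\<close>

datatype cert = Small | LargeL nat | LargeR nat | Target | ExtL cert cert | ExtR cert cert

text \<open>Both lists run outwards from the centre, so passing a head across moves the centre one
  place to the right; with the lists exchanged it moves to the left.\<close>

fun shift :: "nat \<Rightarrow> nat list \<Rightarrow> nat list \<Rightarrow> nat list \<times> nat list" where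
  "shift (Suc k) l (a # r) = shift k (a # l) r"
| "shift _ l r = (l, r)"

lemma window_Cons: "window \<theta> i l (a # r) \<longleftrightarrow> window \<theta> (i + 1) (a # l) r"
  by (auto simp: window_def prefix_of_seq_Cons algebra_simps)

lemma window_shift_right:
  "window \<theta> i l r \<Longrightarrow> shift k l r = (l', r') \<Longrightarrow> \<exists>j. window \<theta> j l' r'"
  by (induction k l r arbitrary: i rule: shift.induct) (auto simp: window_Cons)

lemma window_shift_left:
  "window \<theta> i l r \<Longrightarrow> shift k r l = (r', l') \<Longrightarrow> \<exists>j. window \<theta> j l' r'"
proof (induction k r l arbitrary: i rule: shift.induct)
  case (1 k r a l)
  then show ?case
    using window_Cons[of \<theta> "i - 1" l a r] by auto
qed auto

text \<open>The thresholds are \<open>m / N\<close> and \<open>M / N\<close>: a window is discarded if \<open>lam\<close> is at most \<open>m / N\<close>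
  at its centre, or at least \<open>M / N\<close> at the indicated position.\<close>

fun check :: "int \<Rightarrow> int \<Rightarrow> int \<Rightarrow> (nat list \<Rightarrow> nat list \<Rightarrow> bool) \<Rightarrow> cert \<Rightarrow>
    nat list \<Rightarrow> nat list \<Rightarrow> bool" where
  "check N m M P Small l r = (case lam_bound True l r of (n, d) \<Rightarrow> n * N \<le> m * d)"
| "check N m M P (LargeL k) l r =
     (case shift k r l of (r', l') \<Rightarrow> case lam_bound False l' r' of (n, d) \<Rightarrow> M * d \<le> n * N)"
| "check N m M P (LargeR k) l r =
     (case shift k l r of (l', r') \<Rightarrow> case lam_bound False l' r' of (n, d) \<Rightarrow> M * d \<le> n * N)"
| "check N m M P Target l r = P l r"
| "check N m M P (ExtL c1 c2) l r = (check N m M P c1 (l @ [1]) r \<and> check N m M P c2 (l @ [2]) r)"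
| "check N m M P (ExtR c1 c2) l r = (check N m M P c1 l (r @ [1]) \<and> check N m M P c2 l (r @ [2]))"

lemma window_extend_left:
  "\<lbrakk>\<theta> \<in> biwords; window \<theta> i l r\<rbrakk> \<Longrightarrow> window \<theta> i (l @ [1]) r \<or> window \<theta> i (l @ [2]) r"
  by (auto simp: window_def prefix_of_seq_snoc biwords_def)

lemma window_extend_right:
  "\<lbrakk>\<theta> \<in> biwords; window \<theta> i l r\<rbrakk> \<Longrightarrow> window \<theta> i l (r @ [1]) \<or> window \<theta> i l (r @ [2])"
  by (auto simp: window_def prefix_of_seq_snoc biwords_def)

lemma check_large:
  assumes "\<theta> \<in> biwords" "0 < N" "\<And>i. lam \<theta> i < of_int M / of_int N"
    and "window \<theta> i l r" "lam_bound False l r = (n, d)" "M * d \<le> n * N"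
  shows False
proof -
  have "0 < d" and le: "of_int n / of_int d \<le> lam \<theta> i"
    using lam_bound_correct[OF assms(1,4,5)] by simp_all
  have "real_of_int n / of_int d < of_int M / of_int N"
    using le assms(3)[of i] by linarith
  then have "real_of_int (n * N) < of_int (M * d)"
    using \<open>0 < d\<close> \<open>0 < N\<close> by (simp add: field_simps)
  then show False using assms(6) by linarith
qed

text \<open>Induction on the tree: a branching keeps at least one of its two windows, and every leaf
  except \<open>Target\<close> is contradictory. The upper threshold holds at all positions, the
  lower one only at 0, so only the large leaves move the centre.\<close>

lemma check_correct:
  assumes "\<theta> \<in> biwords" "0 < N" "\<And>i. lam \<theta> i < of_int M / of_int N"
    and m: "of_int m / of_int N < lam \<theta> 0"
    and "check N m M P c l r" "window \<theta> 0 l r"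
  shows "\<exists>l r. window \<theta> 0 l r \<and> P l r"
  using assms(5,6)
proof (induction c arbitrary: l r)
  case Small
  obtain n d where nd: "lam_bound True l r = (n, d)" by fastforce
  have "0 < d" and le: "lam \<theta> 0 \<le> of_int n / of_int d"
    using lam_bound_correct[OF assms(1) Small(2) nd] by simp_all
  have "of_int m / of_int N < real_of_int n / of_int d"
    using le m by linarith
  then have "real_of_int (m * d) < of_int (n * N)"
    using \<open>0 < d\<close> \<open>0 < N\<close> by (simp add: field_simps)
  moreover have "n * N \<le> m * d" using Small(1) nd by (simp del: lam_bound.simps)
  ultimately show ?case by linarith
next
  case (LargeL k)
  obtain l' r' where s: "shift k r l = (r', l')" by fastforce
  obtain n d where nd: "lam_bound False l' r' = (n, d)" by fastforce
  show ?case
    using window_shift_left[OF LargeL(2) s] check_large[OF assms(1-3) _ nd] LargeL(1) s nd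
    by (auto simp del: lam_bound.simps)
next
  case (LargeR k)
  obtain l' r' where s: "shift k l r = (l', r')" by fastforce
  obtain n d where nd: "lam_bound False l' r' = (n, d)" by fastforce
  show ?case
    using window_shift_right[OF LargeR(2) s] check_large[OF assms(1-3) _ nd] LargeR(1) s nd
    by (auto simp del: lam_bound.simps)
next
  case Target
  then show ?case by auto
next
  case (ExtL c1 c2)
  then show ?case using window_extend_left[OF assms(1) ExtL(4)] by auto
next
  case (ExtR c1 c2)
  then show ?case using window_extend_right[OF assms(1) ExtR(4)] by auto
qed

section \<open>The case tree for k = 3\<close>

definition left_word :: "nat list" where
  "left_word = word [(2, 6), (1, 2), (2, 8), (1, 2), (2, 6), (1, 2)]"

definition right_word :: "nat list" where
  "right_word = word [(2, 1), (2, 6), (1, 2), (2, 8), (1, 2), (2, 6), (1, 2), (2, 2)]"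

text \<open>The second alternative is the transposed string: reflection fixes position 0, so the
  starred letter \<open>hd r\<close> stays in front of the new right part. The numbers 26 and 29 are
  the lengths of the two words.\<close>

fun target :: "nat list \<Rightarrow> nat list \<Rightarrow> bool" where
  "target l r \<longleftrightarrow>
     (take 26 l = rev left_word \<and> take 29 r = right_word) \<or>
     (take 26 (tl r) = rev left_word \<and> take 29 (hd r # l) = right_word)"

text \<open>Found by a greedy search that extends the window on the side where more of the two extensions
  are immediately impossible. The tolerance is small: the two thresholds used with this tree differ
  by \<open>8 / 10 ^ 18\<close>, and \<open>markov (periodic (omega 3))\<close> lies between them.\<close>

definition certificate :: cert where
  "certificate =
    ExtR Small (ExtR (ExtR (ExtL (LargeR 0) (ExtL (ExtR (ExtL (ExtR (ExtL (ExtR (ExtL (ExtR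
    (ExtL (ExtR (ExtL (ExtR (ExtL (ExtR (ExtL (ExtR (ExtL (ExtR (ExtL (ExtR (ExtR Small Small)
    (ExtL (ExtR (LargeR 0) (ExtR (ExtL (LargeR 0) Small) (LargeR 12))) (LargeR 0))) Small)
    Small) (ExtR (LargeR 0) (ExtL (LargeL 10) Small))) (LargeR 0)) (LargeL 1)) Small) (ExtR
    (LargeR 0) (ExtL (LargeL 8) (ExtR Small (ExtL (ExtR Small Small) (LargeL 8)))))) (LargeR 0))
    (LargeL 1)) Small) (ExtR (LargeR 0) (ExtL (LargeL 6) (ExtR Small (ExtL (ExtR (ExtL (ExtR
    (ExtR (ExtL Small (ExtL (LargeL 10) (ExtR Small (LargeR 8)))) Small) (LargeR 8)) Small)
    Small) (LargeL 6)))))) (LargeR 0)) (LargeL 1)) Small) (ExtR (LargeR 0) (ExtL (LargeL 4)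
    (ExtR Small (ExtR (ExtL (ExtL (ExtR (ExtL (ExtR (ExtL (ExtR (ExtL (LargeL 5) (ExtR (ExtL
    (LargeL 10) (ExtR Small (LargeR 6))) Small)) (LargeR 6)) Small) Small) (ExtR (LargeR 0)
    (ExtL (LargeL 8) Small))) (LargeR 0)) (LargeL 7)) (LargeR 0)) (LargeR 5)))))) (LargeR 0))
    (LargeL 3)) Small) (ExtR (LargeR 0) (ExtR (LargeR 3) (ExtL (LargeR 0) (ExtL (ExtR (ExtL
    (ExtR (ExtL (LargeL 3) (ExtR (LargeR 0) (ExtL (LargeL 6) (ExtR Small (ExtR (ExtR (ExtL Small
    (ExtL (LargeL 6) (ExtR Small Small))) (LargeR 8)) Small))))) (LargeR 0)) (LargeL 5)) Small)
    (ExtR (LargeR 0) (ExtR (LargeR 3) (ExtL (LargeR 0) (ExtL (ExtR (ExtL (ExtR (ExtR (LargeR 6)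
    Small) (LargeR 6)) (LargeL 7)) Small) (ExtR (LargeR 0) (ExtL (ExtR (LargeR 3) (ExtL (ExtL
    (LargeL 6) (ExtR (ExtR (ExtL (LargeL 9) (ExtR (LargeR 0) (ExtL (LargeL 6) (ExtR Small (ExtL
    (LargeL 9) (ExtR (LargeR 0) (ExtL (LargeL 6) (ExtR Small (ExtL (LargeL 9) (ExtR (LargeR 0)
    (ExtR (LargeR 11) (ExtL (LargeR 0) (ExtL (ExtR (ExtL (ExtR (ExtR (LargeR 16) Small) (LargeR
    16)) (LargeL 17)) Small) (ExtR (LargeR 0) (ExtL (ExtL (ExtR Small (ExtL (LargeL 16) (ExtR
    (ExtR (ExtL (LargeL 19) (ExtR (LargeR 0) (ExtL (LargeL 16) (ExtR Small (ExtL (LargeL 19)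
    (ExtR (LargeR 0) (ExtL (LargeL 16) (ExtR Small (ExtL (LargeL 19) (ExtR (LargeR 18) (ExtL
    (ExtR (LargeR 21) (ExtL (ExtL (LargeL 24) (ExtL (LargeL 27) Target)) (LargeL 26)))
    Small))))))))))) (LargeR 0)) Small))) (LargeL 18)) Small))))))))))))))) (LargeR 0)) Small))
    (LargeL 8))) Small)))))))))))) (LargeR 0)) (ExtL (ExtL (ExtR (ExtR (ExtL (ExtL (ExtR (ExtR
    (ExtL (ExtL (ExtR (ExtR (ExtL (ExtL (ExtR (ExtR (ExtL (ExtL (ExtR (ExtR (ExtL (ExtR (ExtL
    Small (ExtL (LargeL 12) (ExtL (ExtR (LargeR 0) Small) (LargeL 12)))) (ExtL (ExtL Small
    Small) (LargeR 0))) Small) (LargeR 1)) (ExtR (LargeR 10) (ExtL (LargeR 0) Small))) (LargeR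
    0)) Small) (LargeR 1)) (ExtR (LargeR 8) (ExtL (LargeR 0) (ExtR (ExtL Small (ExtL Small
    Small)) (LargeR 8))))) (LargeR 0)) Small) (LargeR 1)) (ExtR (LargeR 6) (ExtL (LargeR 0)
    (ExtR (ExtL Small (ExtR (ExtL (ExtL (ExtL (ExtR Small (ExtR (LargeR 6) (ExtL Small (LargeL
    8)))) Small) (LargeL 10)) Small) (LargeR 7))) (LargeR 6))))) (LargeR 0)) Small) (LargeR 1))
    (ExtR (LargeR 4) (ExtL (LargeR 0) (ExtL Small (ExtL (ExtR (ExtR (ExtL (ExtR (ExtR (ExtL
    (ExtR (LargeR 5) (ExtL (ExtR (LargeR 10) (ExtL (ExtR Small (LargeR 10)) Small)) (LargeL 6)))
    Small) (LargeR 5)) (ExtR (LargeR 8) (ExtL (LargeR 0) Small))) (LargeL 8)) (LargeR 5))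
    (LargeR 0)) (LargeL 5)))))) (LargeR 0)) Small) (LargeR 1)) (ExtL (LargeR 0) (ExtL (LargeL 3)
    (ExtR (LargeR 0) (ExtR (ExtR (ExtL (ExtR (LargeR 3) (ExtL (ExtR (LargeR 6) (ExtL (LargeR 0)
    (ExtL Small (ExtL (ExtL (ExtR Small (ExtR (LargeR 6) (ExtL Small Small))) (LargeL 10))
    Small)))) (LargeL 6))) Small) (LargeR 3)) (ExtL (LargeR 0) (ExtL (LargeL 3) (ExtR (LargeR 0)
    (ExtR (ExtR (ExtL (ExtR (LargeR 5) (ExtL (ExtL (LargeL 6) Small) (LargeL 8))) Small) (LargeR
    5)) (ExtL (LargeR 0) (ExtR (ExtR (ExtL Small (ExtR (LargeR 6) (ExtL (ExtR (LargeR 9) (ExtL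
    (ExtR (LargeR 6) (ExtL (LargeL 8) (ExtR (LargeR 9) (ExtL Small (ExtR (LargeR 6) (ExtL
    (LargeL 8) (ExtR (LargeR 9) (ExtL Small (ExtL (LargeR 0) (ExtL (LargeL 11) (ExtR (LargeR 0)
    (ExtR (ExtR (ExtL (ExtR (LargeR 15) (ExtL (ExtL (LargeL 16) Small) (LargeL 18))) Small)
    (LargeR 9)) (ExtL (LargeR 0) (ExtR (ExtR (ExtL Small (ExtR (LargeR 16) (ExtL (ExtR (LargeR
    19) (ExtL (ExtR (LargeR 16) (ExtL (LargeL 18) (ExtR (LargeR 19) (ExtL Small (ExtR (LargeR
    16) (ExtL (LargeL 18) (ExtR (LargeR 19) (ExtL Small (ExtL (LargeL 18) (ExtR (ExtR (ExtL
    (LargeL 21) (ExtR (LargeR 24) (ExtR (LargeR 27) Target))) (LargeR 24)) Small))))))))))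
    (LargeL 20))) Small))) (LargeR 16)) Small)))))))))))))) (LargeL 10))) Small))) (LargeR 6))
    Small))))))))))) (LargeL 2)) Small))"

text \<open>Divided by \<open>10 ^ 18\<close>, the upper threshold is exactly
  3.00000483430477639.\<close>

lemma check_certificate:
  "check (10 ^ 18) 3000004834304776382 3000004834304776390 target certificate [] []"
  by code_simp

section \<open>A lower bound for the Markov value of the periodic word\<close>

lemma prefix_of_seq_iff_map: "prefix_of_seq w a \<longleftrightarrow> map a [0..<length w] = w"
proof -
  have "map a [0..<length w] = w \<longleftrightarrow> map a [0..<length w] = map ((!) w) [0..<length w]"
    by (simp only: map_nth)
  then show ?thesis
    by (auto simp: prefix_of_seq_def)
qed

text \<open>Position 8 is the first letter of the block of seven 2s, the counterpart of the starred
  entry. The window takes one full period of 27 letters on each side.\<close>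

lemma window_periodic_omega:
  "window (periodic (omega 3)) 8
     (word [(1, 2), (2, 6), (1, 2), (2, 8), (1, 2), (2, 7)])
     (word [(2, 7), (1, 2), (2, 8), (1, 2), (2, 6), (1, 2)])"
  unfolding window_def prefix_of_seq_iff_map by code_simp

text \<open>A supremum is bounded below by any one of its values; the one at position 8, estimated
  from a single period on each side, already exceeds the threshold.\<close>

lemma markov_periodic_omega:
  "3000004834304776382 / 10 ^ 18 < markov (periodic (omega 3))"
proof -
  have "set (omega 3) \<subseteq> {1, 2}" "omega 3 \<noteq> []"
    by (auto simp: omega_def word_def)
  moreover have "w \<noteq> [] \<Longrightarrow> periodic w i \<in> set w" for w i
    unfolding periodic_def by (intro nth_mem) (simp add: nat_less_iff)
  ultimately have bi: "periodic (omega 3) \<in> biwords"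
    unfolding biwords_def by blast
  obtain n d where nd: "lam_bound False (word [(1, 2), (2, 6), (1, 2), (2, 8), (1, 2), (2, 7)])
     (word [(2, 7), (1, 2), (2, 8), (1, 2), (2, 6), (1, 2)]) = (n, d)"
    by fastforce
  have "case lam_bound False (word [(1, 2), (2, 6), (1, 2), (2, 8), (1, 2), (2, 7)])
     (word [(2, 7), (1, 2), (2, 8), (1, 2), (2, 6), (1, 2)]) of
     (n, d) \<Rightarrow> 3000004834304776382 * d < n * 10 ^ 18"
    by code_simp
  then have "3000004834304776382 * d < n * 10 ^ 18"
    by (simp only: nd prod.case)
  then have "real_of_int (3000004834304776382 * d) < of_int (n * 10 ^ 18)"
    by (simp only: of_int_less_iff)
  then have "3000004834304776382 / 10 ^ 18 < real_of_int n / of_int d"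
    using lam_bound_correct(1)[OF bi window_periodic_omega nd] by (simp add: field_simps)
  also have "\<dots> \<le> lam (periodic (omega 3)) 8"
    using lam_bound_correct(2)[OF bi window_periodic_omega nd] by simp
  also have "\<dots> \<le> markov (periodic (omega 3))"
    by (rule lam_le_markov[OF bi])
  finally show ?thesis .
qed

section \<open>From windows to strings and transpositions\<close>

lemma prefix_of_seq_take: "prefix_of_seq w a \<Longrightarrow> prefix_of_seq (take k w) a"
  by (simp add: prefix_of_seq_def)

lemma window_take: "window \<theta> i l r \<Longrightarrow> window \<theta> i (take j l) (take k r)"
  by (simp add: window_def prefix_of_seq_take)

text \<open>Cut the range of positions between -1 and 0. The left part of a window is read outwards
  from the centre, hence the reversal of \<open>u\<close>.\<close>

lemma has_string_iff_window: "has_string \<theta> u v \<longleftrightarrow> window \<theta> 0 (rev u) v"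
proof -
  have split: "[- int (length u)..int (length v) - 1] =
      [- int (length u)..-1] @ [0..int (length v) - 1]"
    using upto_split1[of "- int (length u)" 0 "int (length v) - 1"]
    by (cases "v = []") (auto simp: upto_split1)
  have "map \<theta> [- int (length u)..-1] = u \<longleftrightarrow> prefix_of_seq (rev u) (\<lambda>n. \<theta> (0 - 1 - int n))"
  proof -
    have "rev (map \<theta> [- int (length u)..-1]) = map (\<lambda>n. \<theta> (0 - 1 - int n)) [0..<length u]"
      by (rule nth_equalityI) (auto simp: rev_nth algebra_simps of_nat_diff)
    then show ?thesis
      unfolding prefix_of_seq_iff_map length_rev by (metis rev_rev_ident)
  qed
  moreover have "map \<theta> [0..int (length v) - 1] = v \<longleftrightarrow> prefix_of_seq v (\<lambda>n. \<theta> (0 + int n))"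
  proof -
    have "map \<theta> [0..int (length v) - 1] = map (\<lambda>n. \<theta> (0 + int n)) [0..<length v]"
      by (rule nth_equalityI) simp_all
    then show ?thesis
      unfolding prefix_of_seq_iff_map by simp
  qed
  ultimately show ?thesis
    unfolding has_string_def split map_append window_def
    by (subst append_eq_append_conv) auto
qed

lemma window_transposition:
  "window \<theta> 0 l (a # r) \<Longrightarrow> window (transposition \<theta>) 0 r (a # l)"
  by (auto simp: window_def prefix_of_seq_Cons transposition_def algebra_simps)

theorem lemma6p34:
  fixes \<theta> :: "int \<Rightarrow> nat"
  assumes "admissible 3 3.00000483430477639 \<theta>"
  shows "\<exists>\<theta>' \<in> {\<theta>, transposition \<theta>}.
    has_string \<theta>'
      (word [(2, 6), (1, 2), (2, 8), (1, 2), (2, 6), (1, 2)])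
      (word [(2, 1), (2, 6), (1, 2), (2, 8), (1, 2), (2, 6), (1, 2), (2, 2)]) \<and>
    has_string \<theta>'
      (word [(2, 6), (1, 2), (2, 8), (1, 2), (2, 6), (1, 2)])
      (word [(2, 1), (2, 6), (1, 2), (2, 8), (1, 2), (2, 6), (1, 1)])"
proof -
  have bi: "\<theta> \<in> biwords" and eq: "markov \<theta> = lam \<theta> 0"
    and lo: "markov (periodic (omega 3)) < lam \<theta> 0" and hi: "lam \<theta> 0 < 3.00000483430477639"
    using assms by (auto simp: admissible_def)
  have "\<exists>l r. window \<theta> 0 l r \<and> target l r"
  proof (rule check_correct[OF bi _ _ _ check_certificate])
    \<comment> \<open>The supremum is attained at 0, so the bound there holds at every
      position.\<close>
    show "lam \<theta> i < of_int 3000004834304776390 / of_int (10 ^ 18)" for i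
      using lam_le_markov[OF bi, of i] eq hi by simp
    show "of_int 3000004834304776382 / of_int (10 ^ 18) < lam \<theta> 0"
      using markov_periodic_omega lo by simp
    show "window \<theta> 0 [] []" by (simp add: window_def)
  qed simp
  then obtain l r where w: "window \<theta> 0 l r" and t: "target l r" by blast
  have "\<exists>\<theta>' \<in> {\<theta>, transposition \<theta>}. window \<theta>' 0 (rev left_word) right_word"
    using t unfolding target.simps
  proof
    assume "take 26 l = rev left_word \<and> take 29 r = right_word"
    then show ?thesis using window_take[OF w, of 26 29] by auto
  next
    assume a: "take 26 (tl r) = rev left_word \<and> take 29 (hd r # l) = right_word"
    \<comment> \<open>This makes \<open>hd r\<close> the actual letter at position 0.\<close>
    then have "r \<noteq> []" by (auto simp: left_word_def word_def)
    then have "window (transposition \<theta>) 0 (tl r) (hd r # l)"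
      using w by (intro window_transposition) simp
    then show ?thesis using window_take[of "transposition \<theta>" 0 "tl r" "hd r # l" 26 29] a by auto
  qed
  then obtain \<theta>' where \<theta>': "\<theta>' \<in> {\<theta>, transposition \<theta>}" "window \<theta>' 0 (rev left_word) right_word"
    by blast
  \<comment> \<open>The second string is the first without its last three letters: the ending 1, 1,
    2, 2 is cut to a single 1.\<close>
  have "take 26 (rev left_word) = rev left_word"
      "take 26 right_word = word [(2, 1), (2, 6), (1, 2), (2, 8), (1, 2), (2, 6), (1, 1)]"
    by (simp_all add: left_word_def right_word_def word_def numeral_eq_Suc)
  with window_take[OF \<theta>'(2), of 26 26]
  have "window \<theta>' 0 (rev left_word) (word [(2, 1), (2, 6), (1, 2), (2, 8), (1, 2), (2, 6), (1, 1)])"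
    by simp
  with \<theta>' show ?thesis
    unfolding has_string_iff_window left_word_def right_word_def by blast
qed

end
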